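(* Let $k$ be a field with $1/2\in k$, let $A$ be a commutative noetherian ring over $k$, let $R=A[X]$ be the polynomial ring in one variable, and let $I$ be an ideal of $R$ that contains a monic polynomial. Let $n\geq 1$ and let $\omega:R^n\twoheadrightarrow I/I^2$ be a surjective homomorphism of $R$-modules. Then $\zeta(I,\omega)=[\mathbf{0}]$ in $\pi_0(Q_{2n})(R)$, where $\mathbf{0}:=(0,\ldots,0;0,\ldots,0;0)\in Q_{2n}(R)$.
   Context: For a commutative ring $B$ over $k$ and $n\ge 1$, put $$Q_{2n}(B)=\left\{(f_1,\ldots,f_n;g_1,\ldots,g_n;s)\in B^{2n+1}: \sum_{i=1}^n f_ig_i+s(s-1)=0\right\}.$$ The set $\pi_0(Q_{2n})(B)$ is the pushout in sets of the two evaluation maps $Q_{2n}(B[T])\to Q_{2n}(B)$ at $T=0$ and $T=1$; equivalently, it is the quotient of $Q_{2n}(B)$ by the equivalence relation generated by $H(0)\sim H(1)$ for $H(T)\in Q_{2n}(B[T])$. The class of $\mathbf v\in Q_{2n}(B)$ is written $[\mathbf v]$. For $B$ noetherian, an ideal $I\subseteq B$ and a surjective $B$-linear map $\omega:B^n\twoheadrightarrow I/I^2$ (a local $n$-orientation), the obstruction class $\zeta(I,\omega)\in\pi_0(Q_{2n})(B)$ is defined as follows: choose lifts $f_1,\ldots,f_n\in I$ of $\omega(e_1),\ldots,\omega(e_n)$ (where $e_i$ is the standard basis), so $I=(f_1,\ldots,f_n)+I^2$; by Nakayama's lemma there is $s\in I$ with $(1-s)I\subseteq(f_1,\ldots,f_n)$,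 hence there are $g_1,\ldots,g_n\in B$ with $\sum f_ig_i+s(s-1)=0$; put $\zeta(I,\omega)=[(f_1,\ldots,f_n;g_1,\ldots,g_n;s)]$. This class is known to be independent of all choices. *)

theory Defs
  imports
    "HOL-Analysis.Finite_Cartesian_Product"
    "HOL-Computational_Algebra.Polynomial"
    "HOL-Library.Set_Algebras"
begin

section \<open>Ideals\<close>

text \<open>A commutative ring is a module over itself; its ideals are the submodules, and the
  ideal generated by a set is its span.\<close>

lemma module_times: "module ((*) :: 'b::comm_ring_1 \<Rightarrow> 'b \<Rightarrow> 'b)"
  by unfold_locales (simp_all add: algebra_simps)

definition is_ideal :: "'b::comm_ring_1 set \<Rightarrow> bool" where
  "is_ideal I \<longleftrightarrow> module.subspace (*) I"

definition ideal_gen :: "'b::comm_ring_1 set \<Rightarrow> 'b set" where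
  "ideal_gen S = module.span (*) S"

definition ideal_square :: "'b::comm_ring_1 set \<Rightarrow> 'b set" where
  "ideal_square I = ideal_gen {x * y | x y. x \<in> I \<and> y \<in> I}"

definition noetherian :: "'b::comm_ring_1 itself \<Rightarrow> bool" where
  "noetherian _ \<longleftrightarrow> (\<forall>I :: 'b set. is_ideal I \<longrightarrow> (\<exists>S. finite S \<and> I = ideal_gen S))"

definition is_ring_hom :: "('a::comm_ring_1 \<Rightarrow> 'b::comm_ring_1) \<Rightarrow> bool" where
  "is_ring_hom h \<longleftrightarrow>
     h 1 = 1 \<and> (\<forall>x y. h (x + y) = h x + h y) \<and> (\<forall>x y. h (x * y) = h x * h y)"


section \<open>The quadric and its naive homotopy classes\<close>

text \<open>The index type \<open>'n\<close> has \<open>n = CARD('n) \<ge> 1\<close> elements; the triple \<open>(f, g, s)\<close> stands for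
  \<open>(f\<^sub>1,\<dots>,f\<^sub>n; g\<^sub>1,\<dots>,g\<^sub>n; s)\<close>.\<close>

type_synonym ('b, 'n) tuple2n = "('b ^ 'n) \<times> ('b ^ 'n) \<times> 'b"

definition Q2n :: "('b::comm_ring_1, 'n::finite) tuple2n set" where
  "Q2n = {(f, g, s). (\<Sum>i\<in>UNIV. f $ i * g $ i) + s * (s - 1) = 0}"

definition Q2n_eval ::
    "'b::comm_ring_1 \<Rightarrow> ('b poly, 'n::finite) tuple2n \<Rightarrow> ('b, 'n) tuple2n" where
  "Q2n_eval t = (\<lambda>(F, G, S). (\<chi> i. poly (F $ i) t, \<chi> i. poly (G $ i) t, poly S t))"

definition homotopy_step ::
    "('b::comm_ring_1, 'n::finite) tuple2n \<Rightarrow> ('b, 'n) tuple2n \<Rightarrow> bool" where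
  "homotopy_step v w \<longleftrightarrow> (\<exists>H\<in>Q2n. v = Q2n_eval 0 H \<and> w = Q2n_eval 1 H)"

definition homotopy_rel ::
    "((('b::comm_ring_1, 'n::finite) tuple2n) \<times> ('b, 'n) tuple2n) set" where
  "homotopy_rel = {(v, w). v \<in> Q2n \<and> w \<in> Q2n \<and> equivclp homotopy_step v w}"

lemma Q2n_eval_in_Q2n:
  assumes "H \<in> Q2n"
  shows "Q2n_eval t H \<in> Q2n"
proof -
  obtain F G S where H: "H = (F, G, S)" by (cases H)
  have "poly ((\<Sum>i\<in>UNIV. F $ i * G $ i) + S * (S - 1)) t = 0"
    using assms by (simp add: H Q2n_def)
  then show ?thesis by (simp add: H Q2n_def Q2n_eval_def poly_sum)
qed

lemma equiv_homotopy_rel: "equiv Q2n homotopy_rel"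
proof (rule equivI)
  show "homotopy_rel \<subseteq> Q2n \<times> Q2n" by (auto simp: homotopy_rel_def)
  show "refl_on Q2n homotopy_rel"
    by (rule refl_onI) (auto simp: homotopy_rel_def)
  show "sym homotopy_rel"
    by (auto simp: homotopy_rel_def intro!: symI intro: equivclp_sym)
  show "trans homotopy_rel"
    by (auto simp: homotopy_rel_def intro!: transI intro: equivclp_trans)
qed

definition pi0_Q2n :: "('b::comm_ring_1, 'n::finite) tuple2n set set" where
  "pi0_Q2n = Q2n // homotopy_rel"

definition pi0_class ::
    "('b::comm_ring_1, 'n::finite) tuple2n \<Rightarrow> ('b, 'n) tuple2n set" where
  "pi0_class v = homotopy_rel `` {v}"

lemma pi0_class_in_pi0: "v \<in> Q2n \<Longrightarrow> pi0_class v \<in> pi0_Q2n"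
  by (simp add: pi0_class_def pi0_Q2n_def quotientI)

lemma zero_in_Q2n: "(0, 0, 0) \<in> Q2n"
  by (simp add: Q2n_def)


section \<open>Local orientations and the obstruction class\<close>

text \<open>Elements of \<open>I/I\<^sup>2\<close> are the cosets \<open>x + I\<^sup>2\<close> with \<open>x \<in> I\<close>. The sum of two cosets is their
  elementwise sum. The scalar multiple of \<open>C = x + I\<^sup>2\<close> by \<open>r\<close> is \<open>r C + I\<^sup>2 = r x + I\<^sup>2\<close>; the
  elementwise product \<open>r C\<close> alone may be a proper subset of that coset.\<close>

definition conormal :: "'b::comm_ring_1 set \<Rightarrow> 'b set set" where
  "conormal I = (\<lambda>x. x +o ideal_square I) ` I"

definition local_orientation :: "'b::comm_ring_1 set \<Rightarrow> ('b ^ 'n \<Rightarrow> 'b set) \<Rightarrow> bool" where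
  "local_orientation I \<omega> \<longleftrightarrow>
     range \<omega> = conormal I \<and>
     (\<forall>u v. \<omega> (u + v) = \<omega> u + \<omega> v) \<and>
     (\<forall>r u. \<omega> (r *s u) = (r *o \<omega> u) + ideal_square I)"

text \<open>The triples \<open>(f, g, s)\<close> that can arise from the choices in the construction of the
  obstruction class.\<close>

definition obstruction_data ::
    "'b::comm_ring_1 set \<Rightarrow> ('b ^ 'n \<Rightarrow> 'b set) \<Rightarrow> ('b, 'n) tuple2n set" where
  "obstruction_data I \<omega> = {(f, g, s).
     (\<forall>i. f $ i \<in> I \<and> \<omega> (axis i 1) = f $ i +o ideal_square I) \<and>
     s \<in> I \<and> (\<forall>x\<in>I. (1 - s) * x \<in> ideal_gen (range (($) f))) \<and>
     (\<Sum>i\<in>UNIV. f $ i * g $ i) + s * (s - 1) = 0}"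

text \<open>The definite description picks the unique class produced by the choices; it is
  meaningful because choices exist (for noetherian rings, by Nakayama's lemma) and because the
  class does not depend on them.\<close>

definition obstruction_class ::
    "'b::comm_ring_1 set \<Rightarrow> ('b ^ 'n \<Rightarrow> 'b set) \<Rightarrow> ('b, 'n) tuple2n set" where
  "obstruction_class I \<omega> = (THE c. \<exists>v\<in>obstruction_data I \<omega>. c = pi0_class v)"

end

theory Submission
  imports Defs
begin

text \<open>
  An ideal with a monic element can be moved off to infinity by a homotopy. What remains there is
  a point of the quadric that belongs to the unit ideal, and such a point with \<open>f = 0\<close> is connected
  to the origin. Write \<open>R = A[X]\<close>. The substitution
  \<open>X \<mapsto> X - T + T\<^sup>-\<^sup>1\<close> is the identity at \<open>T = 1\<close>. If \<open>p\<close> has degree at most \<open>N\<close>, then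
  \<open>T\<^sup>N p(X - T + T\<^sup>-\<^sup>1)\<close> is a polynomial in \<open>X\<close> and \<open>T\<close>, whose value at \<open>T = 0\<close> is the coefficient
  of \<open>X\<^sup>N\<close> in \<open>p\<close>. So a monic \<open>p\<close> of degree \<open>N\<close> gives a polynomial \<open>P = 1 - T h\<close>: modulo \<open>P\<close> the
  variable \<open>T\<close> is invertible with inverse \<open>h\<close>, and the factors \<open>T\<^sup>N\<close> can be undone.

  Lift the orientation to \<open>f\<^sub>1,\<dots>,f\<^sub>n\<close> with one monic entry, which is possible since adding
  \<open>X\<^sup>r m\<^sup>2\<close> with \<open>m \<in> I\<close> monic and \<open>r\<close> large changes a lift only by an element of \<open>I\<^sup>2\<close>. For a point
  \<open>(f, g, s)\<close> that computes the class, the tuple with entries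
  \<open>F\<^sub>i = h\<^sup>N T\<^sup>N f\<^sub>i(X - T + T\<^sup>-\<^sup>1)\<close>, for an \<open>N\<close> above all degrees, extends to a
  point \<open>(F, G, S)\<close> of \<open>Q\<^sub>2\<^sub>n(R[T])\<close>. At \<open>T = 1\<close>
  it is again a choice that computes the class of the same orientation; at \<open>T = 0\<close> it is
  \<open>(0, g', 1)\<close>, which is connected to \<open>(0, 0, 0)\<close> by linear homotopies. This is
  \<open>monic_presentation_contractible\<close>.

  The class is given by a definite description, so all choices must be shown to agree. Two sets of
  lifts are joined by the straight segment between them, and Nakayama's lemma over \<open>R[T]\<close> completes
  the segment to a homotopy (\<open>obstruction_data_homotopic\<close>). Nakayama's lemma, both here and for the
  existence of choices, asks for \<open>I\<close> to be finitely generated; as \<open>A\<close> is noetherian and \<open>I\<close>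
  contains a monic polynomial, division by that polynomial gives this directly
  (\<open>finitely_generated_if_monic\<close>).
\<close>

section \<open>Ideals and finite generation\<close>

lemma is_idealI:
  assumes "0 \<in> I" "\<And>x y. x \<in> I \<Longrightarrow> y \<in> I \<Longrightarrow> x + y \<in> I" "\<And>r x. x \<in> I \<Longrightarrow> r * x \<in> I"
  shows "is_ideal I"
  unfolding is_ideal_def by (rule module.subspaceI[OF module_times]) (use assms in auto)

lemma ideal_zero: "is_ideal I \<Longrightarrow> 0 \<in> I"
  unfolding is_ideal_def by (rule module.subspace_0[OF module_times])

lemma ideal_add: "is_ideal I \<Longrightarrow> x \<in> I \<Longrightarrow> y \<in> I \<Longrightarrow> x + y \<in> I"
  unfolding is_ideal_def by (rule module.subspace_add[OF module_times])

lemma ideal_mult_left: "is_ideal I \<Longrightarrow> x \<in> I \<Longrightarrow> r * x \<in> I"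
  unfolding is_ideal_def by (rule module.subspace_scale[OF module_times])

lemma ideal_mult_right: "is_ideal I \<Longrightarrow> x \<in> I \<Longrightarrow> x * r \<in> I"
  using ideal_mult_left[of I x r] by (simp add: mult.commute)

lemma ideal_diff: "is_ideal I \<Longrightarrow> x \<in> I \<Longrightarrow> y \<in> I \<Longrightarrow> x - y \<in> I"
  unfolding is_ideal_def by (rule module.subspace_diff[OF module_times])

lemma ideal_uminus: "is_ideal I \<Longrightarrow> x \<in> I \<Longrightarrow> - x \<in> I"
  unfolding is_ideal_def by (rule module.subspace_neg[OF module_times])

lemma ideal_sum: "is_ideal I \<Longrightarrow> (\<And>x. x \<in> A \<Longrightarrow> f x \<in> I) \<Longrightarrow> sum f A \<in> I"
  unfolding is_ideal_def by (rule module.subspace_sum[OF module_times])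

lemma is_ideal_ideal_gen: "is_ideal (ideal_gen S)"
  unfolding is_ideal_def ideal_gen_def by (rule module.subspace_span[OF module_times])

lemma ideal_gen_base: "x \<in> S \<Longrightarrow> x \<in> ideal_gen S"
  unfolding ideal_gen_def by (rule module.span_base[OF module_times])

lemma ideal_gen_minimal: "S \<subseteq> I \<Longrightarrow> is_ideal I \<Longrightarrow> ideal_gen S \<subseteq> I"
  unfolding is_ideal_def ideal_gen_def by (rule module.span_minimal[OF module_times])

lemma ideal_gen_finite:
  "finite S \<Longrightarrow> ideal_gen S = range (\<lambda>u. \<Sum>y\<in>S. u y * y)"
  unfolding ideal_gen_def by (rule module.span_finite[OF module_times])

lemma is_ideal_ideal_square: "is_ideal (ideal_square I)"
  unfolding ideal_square_def by (rule is_ideal_ideal_gen)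

lemma mult_in_ideal_square: "x \<in> I \<Longrightarrow> y \<in> I \<Longrightarrow> x * y \<in> ideal_square I"
  unfolding ideal_square_def by (rule ideal_gen_base) blast

lemma ideal_square_subset: "is_ideal I \<Longrightarrow> ideal_square I \<subseteq> I"
  unfolding ideal_square_def by (rule ideal_gen_minimal) (auto intro: ideal_mult_left)

lemma in_ideal_gen_range_iff:
  fixes f :: "'b::comm_ring_1 ^ 'n::finite"
  shows "x \<in> ideal_gen (range (($) f)) \<longleftrightarrow> (\<exists>c :: 'b ^ 'n. x = (\<Sum>i\<in>UNIV. f $ i * c $ i))"
proof
  let ?C = "{x. \<exists>c :: 'b ^ 'n. x = (\<Sum>i\<in>UNIV. f $ i * c $ i)}"
  have "is_ideal ?C"
  proof (rule is_idealI)
    show "0 \<in> ?C" by (auto intro!: exI[of _ 0])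
  next
    fix x y assume "x \<in> ?C" "y \<in> ?C"
    then obtain c d :: "'b ^ 'n" where
      "x = (\<Sum>i\<in>UNIV. f $ i * c $ i)" "y = (\<Sum>i\<in>UNIV. f $ i * d $ i)" by blast
    then have "x + y = (\<Sum>i\<in>UNIV. f $ i * (c + d) $ i)"
      by (simp add: sum.distrib algebra_simps)
    then show "x + y \<in> ?C" by blast
  next
    fix r x assume "x \<in> ?C"
    then obtain c :: "'b ^ 'n" where "x = (\<Sum>i\<in>UNIV. f $ i * c $ i)" by blast
    then have "r * x = (\<Sum>i\<in>UNIV. f $ i * (r *s c) $ i)"
      by (simp add: sum_distrib_left algebra_simps)
    then show "r * x \<in> ?C" by blast
  qed
  moreover have "range (($) f) \<subseteq> ?C"
  proof (clarsimp)
    fix i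
    have "f $ i = (\<Sum>j\<in>UNIV. if j = i then f $ j else 0)" by simp
    also have "\<dots> = (\<Sum>j\<in>UNIV. f $ j * (axis i 1 :: 'b ^ 'n) $ j)"
      by (intro sum.cong) (auto simp: axis_def)
    finally show "\<exists>c :: 'b ^ 'n. f $ i = (\<Sum>j\<in>UNIV. f $ j * c $ j)" by blast
  qed
  ultimately show "x \<in> ideal_gen (range (($) f)) \<Longrightarrow> \<exists>c :: 'b ^ 'n. x = (\<Sum>i\<in>UNIV. f $ i * c $ i)"
    using ideal_gen_minimal by blast
next
  assume "\<exists>c :: 'b ^ 'n. x = (\<Sum>i\<in>UNIV. f $ i * c $ i)"
  moreover have "(\<Sum>i\<in>UNIV. f $ i * c $ i) \<in> ideal_gen (range (($) f))" for c :: "'b ^ 'n"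
    by (rule ideal_sum[OF is_ideal_ideal_gen], rule ideal_mult_right[OF is_ideal_ideal_gen],
        rule ideal_gen_base) simp
  ultimately show "x \<in> ideal_gen (range (($) f))" by blast
qed

text \<open>Only degrees below that of the monic polynomial matter: a higher leading term is removed by
  a multiple of it. In each of the finitely many remaining degrees the leading coefficients form an
  ideal of \<open>A\<close>, and polynomials in \<open>I\<close> that realise generators of these ideals, together with the
  monic polynomial, generate \<open>I\<close>.\<close>

lemma finitely_generated_if_monic:
  fixes I :: "'a::comm_ring_1 poly set"
  assumes noeth: "noetherian TYPE('a)" and I: "is_ideal I" and m: "m \<in> I" "lead_coeff m = 1"
  shows "\<exists>S. finite S \<and> I = ideal_gen S"
proof -
  define L where "L k = {coeff p k | p. p \<in> I \<and> (\<forall>j>k. coeff p j = 0)}" for k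
  have "is_ideal (L k)" for k
  proof (rule is_idealI)
    show "0 \<in> L k" unfolding L_def using ideal_zero[OF I] by (force intro: exI[of _ 0])
  next
    fix x y assume "x \<in> L k" "y \<in> L k"
    then obtain p q where "p \<in> I" "\<forall>j>k. coeff p j = 0" "x = coeff p k"
      "q \<in> I" "\<forall>j>k. coeff q j = 0" "y = coeff q k" unfolding L_def by blast
    then show "x + y \<in> L k"
      unfolding L_def by (auto intro!: exI[of _ "p + q"] ideal_add[OF I])
  next
    fix r x assume "x \<in> L k"
    then obtain p where "p \<in> I" "\<forall>j>k. coeff p j = 0" "x = coeff p k" unfolding L_def by blast
    then show "r * x \<in> L k"
      unfolding L_def by (auto intro!: exI[of _ "[:r:] * p"] ideal_mult_left[OF I])
  qed
  then have "\<exists>S. finite S \<and> L k = ideal_gen S" for k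
    using noeth unfolding noetherian_def by blast
  then obtain S where "\<forall>k. finite (S k) \<and> L k = ideal_gen (S k)"
    using choice[of "\<lambda>k S. finite S \<and> L k = ideal_gen S"] by blast
  then have S: "\<And>k. finite (S k)" "\<And>k. L k = ideal_gen (S k)" by auto
  have "\<exists>p. p \<in> I \<and> (\<forall>j>k. coeff p j = 0) \<and> a = coeff p k" if "a \<in> S k" for a k
    using ideal_gen_base[OF that] S(2)[of k] unfolding L_def by blast
  then have "\<forall>k a. \<exists>p. a \<in> S k \<longrightarrow> p \<in> I \<and> (\<forall>j>k. coeff p j = 0) \<and> a = coeff p k"
    by blast
  then obtain l where "\<forall>k a. a \<in> S k \<longrightarrow>
      l k a \<in> I \<and> (\<forall>j>k. coeff (l k a) j = 0) \<and> a = coeff (l k a) k"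
    unfolding choice_iff by blast
  then have l: "\<And>k a. a \<in> S k \<Longrightarrow> l k a \<in> I"
     "\<And>k a j. a \<in> S k \<Longrightarrow> k < j \<Longrightarrow> coeff (l k a) j = 0"
     "\<And>k a. a \<in> S k \<Longrightarrow> coeff (l k a) k = a" by auto
  define X where "X = insert m (\<Union>k<degree m. l k ` S k)"
  have X: "is_ideal (ideal_gen X)" by (rule is_ideal_ideal_gen)
  have XI: "X \<subseteq> I" using m(1) l(1) by (auto simp: X_def)
  have step: "\<exists>r\<in>ideal_gen X. (\<forall>j>k. coeff r j = 0) \<and> coeff r k = coeff p k"
    if p: "p \<in> I" "\<forall>j>k. coeff p j = 0" for k p
  proof (cases "k < degree m")
    case True
    have "coeff p k \<in> L k" using p unfolding L_def by blast
    then obtain u where u: "coeff p k = (\<Sum>a\<in>S k. u a * a)"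
      using S(2) ideal_gen_finite[OF S(1)] by auto
    let ?r = "\<Sum>a\<in>S k. [:u a:] * l k a"
    have "?r \<in> ideal_gen X"
      by (rule ideal_sum[OF X], rule ideal_mult_left[OF X], rule ideal_gen_base)
         (use True in \<open>auto simp: X_def\<close>)
    moreover have "coeff ?r j = 0" if "k < j" for j
      using l(2) that by (simp add: coeff_sum)
    moreover have "coeff ?r k = coeff p k"
      using l(3) by (simp add: coeff_sum u)
    ultimately show ?thesis by blast
  next
    case False
    let ?r = "monom (coeff p k) (k - degree m) * m"
    have "?r \<in> ideal_gen X" by (intro ideal_mult_left[OF X] ideal_gen_base) (simp add: X_def)
    moreover have "coeff ?r j = 0" if "k < j" for j
      using False that by (simp add: coeff_monom_mult coeff_eq_0)
    moreover have "coeff ?r k = coeff p k"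
      using False m(2) by (simp add: coeff_monom_mult)
    ultimately show ?thesis by blast
  qed
  have "p \<in> ideal_gen X" if "p \<in> I" "\<forall>j\<ge>k. coeff p j = 0" for k p
    using that
  proof (induction k arbitrary: p)
    case 0
    then have "p = 0" by (simp add: poly_eq_iff)
    then show ?case using ideal_zero[OF X] by simp
  next
    case (Suc k)
    then obtain r where r: "r \<in> ideal_gen X" "\<forall>j>k. coeff r j = 0" "coeff r k = coeff p k"
      using step[of p k] by auto
    have rI: "r \<in> I" using r(1) ideal_gen_minimal[OF XI I] by blast
    have "coeff (p - r) j = 0" if "k \<le> j" for j
      using Suc.prems(2) r that by (cases "j = k") auto
    then have "p - r \<in> ideal_gen X"
      using Suc.IH[of "p - r"] ideal_diff[OF I Suc.prems(1) rI] by blast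
    then show ?case using ideal_add[OF X _ r(1), of "p - r"] by simp
  qed
  then have "p \<in> ideal_gen X" if "p \<in> I" for p
    using that coeff_eq_0[of p] by (meson less_eq_Suc_le)
  then have "I = ideal_gen X" using ideal_gen_minimal[OF XI I] by blast
  moreover have "finite X" unfolding X_def using S(1) by simp
  ultimately show ?thesis by blast
qed

section \<open>Nakayama's lemma\<close>

text \<open>Gaussian elimination in place of a determinant: modulo \<open>J\<close>, the equation of a generator
  \<open>z\<close> expresses \<open>(1 - a z) * z\<close> through the others. Multiplying the other equations by
  \<open>1 - a z\<close>, which is \<open>1\<close> modulo \<open>I\<close>, lets \<open>z\<close> be removed without changing their shape.\<close>

lemma nakayama_elimination:
  fixes I J :: "'b::comm_ring_1 set"
  assumes I: "is_ideal I" and J: "is_ideal J" and "finite X"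
    and "\<And>x. x \<in> X \<Longrightarrow> \<exists>a. (\<forall>y\<in>X. a y \<in> I) \<and> x - (\<Sum>y\<in>X. a y * y) \<in> J"
  shows "\<exists>s\<in>I. \<forall>x\<in>X. (1 - s) * x \<in> J"
  using assms(3,4)
proof (induction X rule: finite_induct)
  case empty
  then show ?case using ideal_zero[OF I] by auto
next
  case (insert z X)
  obtain a where a: "\<And>y. y \<in> insert z X \<Longrightarrow> a y \<in> I" and
      "z - (\<Sum>y\<in>insert z X. a y * y) \<in> J"
    using insert.prems[of z] by auto
  then have z: "(1 - a z) * z - (\<Sum>y\<in>X. a y * y) \<in> J"
    using insert.hyps by (simp add: algebra_simps)
  have "\<exists>c. (\<forall>y\<in>X. c y \<in> I) \<and> x - (\<Sum>y\<in>X. c y * y) \<in> J" if x: "x \<in> X" for x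
  proof -
    obtain b where b: "\<And>y. y \<in> insert z X \<Longrightarrow> b y \<in> I"
      and "x - (\<Sum>y\<in>insert z X. b y * y) \<in> J"
      using insert.prems[of x] x by auto
    then have "x - b z * z - (\<Sum>y\<in>X. b y * y) \<in> J"
      using insert.hyps by (simp add: algebra_simps)
    then have J1: "(1 - a z) * (x - b z * z - (\<Sum>y\<in>X. b y * y)) +
        b z * ((1 - a z) * z - (\<Sum>y\<in>X. a y * y)) \<in> J"
      by (intro ideal_add[OF J] ideal_mult_left[OF J] z)
    \<comment> \<open>The summand at \<open>y = x\<close> turns \<open>(1 - a z) * x\<close> back into \<open>x\<close> minus a multiple by \<open>I\<close>.\<close>
    define c where "c y = b z * a y + (1 - a z) * b y + (if y = x then a z else 0)" for y
    have "c y \<in> I" if "y \<in> X" for y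
      unfolding c_def using that a b ideal_zero[OF I]
      by (auto intro!: ideal_add[OF I] ideal_mult_left[OF I])
    moreover have "(\<Sum>y\<in>X. c y * y) =
        b z * (\<Sum>y\<in>X. a y * y) + (1 - a z) * (\<Sum>y\<in>X. b y * y) + a z * x"
    proof -
      have "(\<Sum>y\<in>X. (if y = x then a z else 0) * y) = a z * x"
        using insert.hyps(1) x by (simp add: if_distrib[of "\<lambda>t. t * _"] cong: if_cong)
      then show ?thesis
        unfolding c_def distrib_right sum.distrib sum_distrib_left by (simp add: mult.assoc)
    qed
    then have "x - (\<Sum>y\<in>X. c y * y) = (1 - a z) * (x - b z * z - (\<Sum>y\<in>X. b y * y)) +
        b z * ((1 - a z) * z - (\<Sum>y\<in>X. a y * y))"
      by (simp add: algebra_simps)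
    ultimately show ?thesis using J1 by (metis (no_types, lifting))
  qed
  then obtain s where s: "s \<in> I" "\<And>x. x \<in> X \<Longrightarrow> (1 - s) * x \<in> J"
    using insert.IH by blast
  define t where "t = s + (1 - s) * a z"
  have t: "1 - t = (1 - s) * (1 - a z)" by (simp add: t_def algebra_simps)
  have "t \<in> I" unfolding t_def using s(1) a by (auto intro!: ideal_add[OF I] ideal_mult_left[OF I])
  moreover have "(1 - t) * x \<in> J" if "x \<in> X" for x
    using ideal_mult_left[OF J s(2)[OF that], of "1 - a z"] by (simp add: t mult_ac)
  moreover have "(1 - t) * z \<in> J"
  proof -
    have "(1 - s) * ((1 - a z) * z - (\<Sum>y\<in>X. a y * y)) + (\<Sum>y\<in>X. a y * ((1 - s) * y)) \<in> J"
      by (intro ideal_add[OF J] ideal_mult_left[OF J] z ideal_sum[OF J] s(2))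
    also have "(\<Sum>y\<in>X. a y * ((1 - s) * y)) = (1 - s) * (\<Sum>y\<in>X. a y * y)"
      by (simp add: sum_distrib_left mult_ac)
    finally show ?thesis by (simp add: t algebra_simps)
  qed
  ultimately show ?case by blast
qed

lemma nakayama:
  fixes I J :: "'b::comm_ring_1 set"
  assumes fg: "finite X" "I = ideal_gen X" and J: "is_ideal J"
    and gen: "\<And>x. x \<in> I \<Longrightarrow> \<exists>j\<in>J. x - j \<in> ideal_square I"
  shows "\<exists>s\<in>I. \<forall>x\<in>I. (1 - s) * x \<in> J"
proof -
  have I: "is_ideal I" using fg is_ideal_ideal_gen by simp
  have square: "\<exists>a. (\<forall>y\<in>X. a y \<in> I) \<and> x = (\<Sum>y\<in>X. a y * y)" if "x \<in> ideal_square I" for x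
  proof -
    let ?C = "{x. \<exists>a. (\<forall>y\<in>X. a y \<in> I) \<and> x = (\<Sum>y\<in>X. a y * y)}"
    have "is_ideal ?C"
    proof (rule is_idealI)
      show "0 \<in> ?C" using ideal_zero[OF I] by (auto intro!: exI[of _ "\<lambda>_. 0"])
    next
      fix x y assume "x \<in> ?C" "y \<in> ?C"
      then obtain a b where "\<forall>y\<in>X. a y \<in> I" "x = (\<Sum>y\<in>X. a y * y)"
        "\<forall>y\<in>X. b y \<in> I" "y = (\<Sum>y\<in>X. b y * y)" by blast
      then show "x + y \<in> ?C"
        by (auto intro!: exI[of _ "\<lambda>y. a y + b y"] ideal_add[OF I] simp: sum.distrib distrib_right)
    next
      fix r x assume "x \<in> ?C"
      then obtain a where "\<forall>y\<in>X. a y \<in> I" "x = (\<Sum>y\<in>X. a y * y)" by blast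
      then show "r * x \<in> ?C"
        by (auto intro!: exI[of _ "\<lambda>y. r * a y"] ideal_mult_left[OF I]
            simp: sum_distrib_left mult.assoc)
    qed
    moreover have "{x * y | x y. x \<in> I \<and> y \<in> I} \<subseteq> ?C"
    proof safe
      fix x y assume x: "x \<in> I" and y: "y \<in> I"
      obtain u where "y = (\<Sum>v\<in>X. u v * v)" using y fg ideal_gen_finite by auto
      then have "x * y = (\<Sum>v\<in>X. (x * u v) * v)" by (simp add: sum_distrib_left mult.assoc)
      then show "\<exists>a. (\<forall>y\<in>X. a y \<in> I) \<and> x * y = (\<Sum>y\<in>X. a y * y)"
        using ideal_mult_right[OF I x] by (intro exI[of _ "\<lambda>v. x * u v"]) simp
    qed
    ultimately have "ideal_square I \<subseteq> ?C"
      unfolding ideal_square_def by (rule ideal_gen_minimal[rotated])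
    then show ?thesis using that by blast
  qed
  have "\<exists>a. (\<forall>y\<in>X. a y \<in> I) \<and> x - (\<Sum>y\<in>X. a y * y) \<in> J" if "x \<in> X" for x
  proof -
    have "x \<in> I" using ideal_gen_base[OF that] fg(2) by simp
    then obtain j where j: "j \<in> J" "x - j \<in> ideal_square I"
      using gen by blast
    obtain a where "\<forall>y\<in>X. a y \<in> I" "x - j = (\<Sum>y\<in>X. a y * y)" using square[OF j(2)] by blast
    moreover from this have "x - (\<Sum>y\<in>X. a y * y) = j" by (simp add: algebra_simps)
    ultimately show ?thesis using j(1) by (intro exI[of _ a]) simp
  qed
  from nakayama_elimination[OF I J fg(1) this]
  obtain s where s: "s \<in> I" "\<And>x. x \<in> X \<Longrightarrow> (1 - s) * x \<in> J" by blast
  have "is_ideal {x. (1 - s) * x \<in> J}"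
    by (rule is_idealI)
       (auto simp: ideal_zero[OF J] distrib_left mult.left_commute[of "1 - s"]
         intro: ideal_add[OF J] ideal_mult_left[OF J])
  then have "I \<subseteq> {x. (1 - s) * x \<in> J}"
    unfolding fg(2) by (rule ideal_gen_minimal[rotated]) (use s(2) in blast)
  then show ?thesis using s(1) by blast
qed

section \<open>Orientations as cosets of lifts\<close>

lemma coset_eq_iff:
  assumes J: "is_ideal J"
  shows "x +o J = y +o J \<longleftrightarrow> x - y \<in> J"
proof
  assume "x +o J = y +o J"
  then show "x - y \<in> J"
    using set_plus_intro2[OF ideal_zero[OF J], of x] by (simp add: set_minus_plus)
next
  have sub: "a +o J \<subseteq> b +o J" if "a - b \<in> J" for a b
  proof
    fix z assume "z \<in> a +o J"
    then have "z - a \<in> J" by (simp add: set_minus_plus)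
    from ideal_add[OF J this that] show "z \<in> b +o J" by (simp flip: set_minus_plus)
  qed
  assume "x - y \<in> J"
  moreover from this have "y - x \<in> J" using ideal_uminus[OF J, of "x - y"] by simp
  ultimately show "x +o J = y +o J" using sub by blast
qed

text \<open>Every \<open>x + I\<^sup>2\<close> is a value of \<open>\<omega>\<close>, hence by linearity a combination of the values on the
  standard basis. This is the hypothesis that Nakayama's lemma asks for.\<close>

lemma orientation_lifts_generate:
  fixes f :: "'b::comm_ring_1 ^ 'n::finite"
  assumes or: "local_orientation I \<omega>"
    and f: "\<And>i. \<omega> (axis i 1) = f $ i +o ideal_square I" and x: "x \<in> I"
  shows "\<exists>j\<in>ideal_gen (range (($) f)). x - j \<in> ideal_square I"
proof -
  let ?K = "ideal_square I"
  have K: "is_ideal ?K" by (rule is_ideal_ideal_square)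
  have KK: "?K + ?K = ?K"
    using ideal_zero[OF K] ideal_add[OF K] by (auto elim!: set_plus_elim dest: set_zero_plus2)
  have add: "\<omega> (u + v) = \<omega> u + \<omega> v" and scale: "\<omega> (r *s u) = (r *o \<omega> u) + ?K" for u v r
    using or unfolding local_orientation_def by blast+
  have smult: "\<omega> (r *s u) = (r * a) +o ?K" if "\<omega> u = a +o ?K" for r u a
  proof -
    have "r *o ?K + ?K = ?K"
    proof
      show "r *o ?K + ?K \<subseteq> ?K"
        by (auto elim!: set_plus_elim simp: elt_set_times_def
            intro!: ideal_add[OF K] ideal_mult_left[OF K])
      have "0 \<in> r *o ?K" using ideal_zero[OF K] by (force simp: elt_set_times_def)
      then show "?K \<subseteq> r *o ?K + ?K" by (rule set_zero_plus2)
    qed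
    then show ?thesis
      by (simp add: scale that set_times_plus_distrib set_plus_rearrange3)
  qed
  have "\<exists>a. \<omega> 0 = a +o ?K" using or unfolding local_orientation_def conormal_def by blast
  then have zero: "\<omega> 0 = 0 +o ?K" using smult[of 0 _ 0] by auto
  obtain u where u: "\<omega> u = x +o ?K"
    using or x unfolding local_orientation_def conormal_def by (metis imageI rangeE)
  have "\<omega> (\<Sum>i\<in>A. u $ i *s axis i 1) = (\<Sum>i\<in>A. u $ i * f $ i) +o ?K" if "finite A" for A
    using that
    by (induction A rule: finite_induct)
       (simp_all add: zero[simplified] add smult[OF f] set_plus_rearrange KK)
  from this[OF finite_class.finite_UNIV] have "\<omega> (\<Sum>i\<in>UNIV. u $ i *s axis i 1) = (\<Sum>i\<in>UNIV. u $ i * f $ i) +o ?K" .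
  moreover have "(\<Sum>i\<in>UNIV. u $ i *s axis i 1) = u"
  proof (simp add: vec_eq_iff, rule allI)
    fix j
    have "(\<Sum>i\<in>UNIV. u $ i * (axis i 1 :: 'b ^ 'n) $ j) = (\<Sum>i\<in>UNIV. if i = j then u $ i else 0)"
      by (intro sum.cong) (auto simp: axis_def)
    then show "(\<Sum>i\<in>UNIV. u $ i * (axis i 1 :: 'b ^ 'n) $ j) = u $ j" by simp
  qed
  ultimately have "x - (\<Sum>i\<in>UNIV. u $ i * f $ i) \<in> ?K"
    using u coset_eq_iff[OF K] by metis
  moreover have "(\<Sum>i\<in>UNIV. u $ i * f $ i) \<in> ideal_gen (range (($) f))"
    unfolding in_ideal_gen_range_iff by (intro exI[of _ u]) (simp add: mult.commute)
  ultimately show ?thesis by blast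
qed

section \<open>Independence of the choices\<close>

lemma homotopicI:
  assumes "(F, G, S) \<in> Q2n" "Q2n_eval 0 (F, G, S) = v" "Q2n_eval 1 (F, G, S) = w"
  shows "equivclp homotopy_step v w"
  using assms by (intro r_into_equivclp) (auto simp: homotopy_step_def)

lemma sum_const_poly: "(\<Sum>i\<in>A. [:c i:]) = [:sum c A:]"
  by (rule poly_eqI) (simp add: coeff_sum coeff_pCons split: nat.split)

lemma sum_poly3: "(\<Sum>i\<in>A. [:a i, b i, c i:]) = [:sum a A, sum b A, sum c A:]"
  by (rule poly_eqI) (simp add: coeff_sum coeff_pCons split: nat.split)

text \<open>With \<open>f\<close> fixed, the segment \<open>(1 - T) s + T s'\<close> is idempotent modulo \<open>f\<close> all along, because
  the mixed products \<open>(1 - s) s'\<close> and \<open>(1 - s') s\<close> lie in \<open>(f)\<close> as well. If \<open>c\<close> and \<open>d\<close> are their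
  coefficient vectors, the witness is \<open>(1 - T)\<^sup>2 g + T (1 - T) (c + d) + T\<^sup>2 g'\<close>, so the same
  homotopy takes \<open>g\<close> to \<open>g'\<close>.\<close>

lemma homotopic_same_lifts:
  fixes f g g' :: "'b::comm_ring_1 ^ 'n::finite"
  assumes v: "(f, g, s) \<in> Q2n" and w: "(f, g', s') \<in> Q2n"
    and s: "(1 - s) * s' \<in> ideal_gen (range (($) f))"
    and s': "(1 - s') * s \<in> ideal_gen (range (($) f))"
  shows "equivclp homotopy_step (f, g, s) (f, g', s')"
proof -
  obtain c d :: "'b ^ 'n" where c: "(1 - s) * s' = (\<Sum>i\<in>UNIV. f $ i * c $ i)"
    and d: "(1 - s') * s = (\<Sum>i\<in>UNIV. f $ i * d $ i)"
    using s s' unfolding in_ideal_gen_range_iff by blast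
  define F where "F = (\<chi> i. [:f $ i:])"
  define G where "G = (\<chi> i. [:g $ i, c $ i + d $ i - g $ i - g $ i, g $ i + g' $ i - c $ i - d $ i:])"
  define S where "S = [:s, s' - s:]"
  have g: "(\<Sum>i\<in>UNIV. f $ i * g $ i) = s - s * s" "(\<Sum>i\<in>UNIV. f $ i * g' $ i) = s' - s' * s'"
    using v w by (simp_all add: Q2n_def algebra_simps eq_neg_iff_add_eq_0)
  have cd: "(\<Sum>i\<in>UNIV. f $ i * c $ i) = s' - s * s'" "(\<Sum>i\<in>UNIV. f $ i * d $ i) = s - s * s'"
    using c d by (simp_all add: algebra_simps)
  have FG: "F $ i * G $ i = [:f $ i * g $ i, f $ i * c $ i + f $ i * d $ i - f $ i * g $ i - f $ i * g $ i,
      f $ i * g $ i + f $ i * g' $ i - f $ i * c $ i - f $ i * d $ i:]" for i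
    by (simp add: F_def G_def algebra_simps)
  have "(\<Sum>i\<in>UNIV. F $ i * G $ i) + S * (S - 1) = 0"
    unfolding FG sum_poly3 sum.distrib sum_subtractf g cd
    by (simp add: S_def one_pCons algebra_simps)
  then have "(F, G, S) \<in> Q2n" by (simp add: Q2n_def)
  then show ?thesis
    by (rule homotopicI) (simp_all add: Q2n_eval_def F_def G_def S_def vec_eq_iff)
qed

definition extended_ideal :: "'b::comm_ring_1 set \<Rightarrow> 'b poly set" where
  "extended_ideal I = ideal_gen ((\<lambda>x. [:x:]) ` I)"

lemma is_ideal_extended_ideal: "is_ideal (extended_ideal I)"
  unfolding extended_ideal_def by (rule is_ideal_ideal_gen)

lemma const_in_extended_ideal: "x \<in> I \<Longrightarrow> [:x:] \<in> extended_ideal I"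
  unfolding extended_ideal_def by (rule ideal_gen_base) blast

lemma is_ideal_const_preimage:
  assumes K: "is_ideal K"
  shows "is_ideal {x. [:x:] \<in> K}"
proof (rule is_idealI)
  show "0 \<in> {x. [:x:] \<in> K}" using ideal_zero[OF K] by simp
next
  fix x y assume "x \<in> {x. [:x:] \<in> K}" "y \<in> {x. [:x:] \<in> K}"
  then show "x + y \<in> {x. [:x:] \<in> K}" using ideal_add[OF K, of "[:x:]" "[:y:]"] by simp
next
  fix r x assume "x \<in> {x. [:x:] \<in> K}"
  then show "r * x \<in> {x. [:x:] \<in> K}" using ideal_mult_left[OF K, of "[:x:]" "[:r:]"] by (simp add: mult.commute)
qed

lemma extended_ideal_ideal_gen: "extended_ideal (ideal_gen X) = ideal_gen ((\<lambda>x. [:x:]) ` X)"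
proof
  let ?K = "ideal_gen ((\<lambda>x. [:x:]) ` X)"
  have "ideal_gen X \<subseteq> {x. [:x:] \<in> ?K}"
    by (intro ideal_gen_minimal is_ideal_const_preimage is_ideal_ideal_gen)
       (auto intro: ideal_gen_base)
  then show "extended_ideal (ideal_gen X) \<subseteq> ?K"
    unfolding extended_ideal_def by (intro ideal_gen_minimal[OF _ is_ideal_ideal_gen]) blast
  show "?K \<subseteq> extended_ideal (ideal_gen X)"
    by (intro ideal_gen_minimal[OF _ is_ideal_extended_ideal])
       (auto intro: const_in_extended_ideal ideal_gen_base)
qed

lemma poly_in_ideal:
  assumes I: "is_ideal I" and P: "P \<in> extended_ideal I"
  shows "poly P t \<in> I"
proof -
  have "is_ideal {P. poly P t \<in> I}"
    by (rule is_idealI)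
       (auto simp: ideal_zero[OF I] intro: ideal_add[OF I] ideal_mult_left[OF I])
  then have "extended_ideal I \<subseteq> {P. poly P t \<in> I}"
    unfolding extended_ideal_def by (intro ideal_gen_minimal) auto
  then show ?thesis using P by blast
qed

lemma const_in_square_extended_ideal:
  assumes "x \<in> ideal_square I"
  shows "[:x:] \<in> ideal_square (extended_ideal I)"
proof -
  let ?K = "ideal_square (extended_ideal I)"
  have "x * y \<in> {x. [:x:] \<in> ?K}" if "x \<in> I" "y \<in> I" for x y
    using mult_in_ideal_square[OF const_in_extended_ideal[OF that(1)] const_in_extended_ideal[OF that(2)]]
    by (simp add: mult.commute)
  then have "ideal_square I \<subseteq> {x. [:x:] \<in> ?K}"
    unfolding ideal_square_def[of I]
    by (intro ideal_gen_minimal is_ideal_const_preimage is_ideal_ideal_square) blast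
  then show ?thesis using assms by blast
qed

lemma is_ideal_congruent:
  assumes J: "is_ideal J" and K: "is_ideal K"
  shows "is_ideal {x. \<exists>j\<in>J. x - j \<in> K}"
proof (rule is_idealI)
  show "0 \<in> {x. \<exists>j\<in>J. x - j \<in> K}"
    using ideal_zero[OF J] ideal_zero[OF K] by (auto intro!: bexI[of _ 0])
next
  fix x y assume "x \<in> {x. \<exists>j\<in>J. x - j \<in> K}" "y \<in> {x. \<exists>j\<in>J. x - j \<in> K}"
  then obtain i j where "i \<in> J" "x - i \<in> K" "j \<in> J" "y - j \<in> K" by blast
  then have "i + j \<in> J" "(x - i) + (y - j) \<in> K"
    by (auto intro: ideal_add[OF J] ideal_add[OF K])
  then show "x + y \<in> {x. \<exists>j\<in>J. x - j \<in> K}"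
    by (auto intro!: bexI[of _ "i + j"] simp: algebra_simps)
next
  fix r x assume "x \<in> {x. \<exists>j\<in>J. x - j \<in> K}"
  then obtain j where "j \<in> J" "x - j \<in> K" by blast
  then have "r * j \<in> J" "r * (x - j) \<in> K"
    by (auto intro: ideal_mult_left[OF J] ideal_mult_left[OF K])
  then show "r * x \<in> {x. \<exists>j\<in>J. x - j \<in> K}"
    by (auto intro!: bexI[of _ "r * j"] simp: algebra_simps)
qed

text \<open>The segment \<open>F = f + T (f' - f)\<close> still generates the extension of \<open>I\<close> modulo its square,
  since \<open>f' - f\<close> has entries in \<open>I\<^sup>2\<close>. Nakayama's lemma over \<open>B[T]\<close> therefore yields an \<open>S\<close>
  and a homotopy from some choice with lifts \<open>f\<close> to some choice with lifts \<open>f'\<close>; the ends are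
  adjusted by \<open>homotopic_same_lifts\<close>.\<close>

lemma obstruction_data_homotopic:
  fixes I :: "'b::comm_ring_1 set" and v w :: "('b, 'n::finite) tuple2n"
  assumes fg: "finite X" "I = ideal_gen X"
    and v: "v \<in> obstruction_data I \<omega>" and w: "w \<in> obstruction_data I \<omega>"
  shows "equivclp homotopy_step v w"
proof -
  have I: "is_ideal I" using fg is_ideal_ideal_gen by simp
  obtain f g s where v_eq: "v = (f, g, s)" by (cases v)
  obtain f' g' s' where w_eq: "w = (f', g', s')" by (cases w)
  have f: "\<And>i. \<omega> (axis i 1) = f $ i +o ideal_square I" and s: "s \<in> I"
    and gen: "\<And>x. x \<in> I \<Longrightarrow> (1 - s) * x \<in> ideal_gen (range (($) f))" and vQ: "(f, g, s) \<in> Q2n"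
    using v by (auto simp: v_eq obstruction_data_def Q2n_def)
  have f': "\<And>i. \<omega> (axis i 1) = f' $ i +o ideal_square I" and s': "s' \<in> I"
    and gen': "\<And>x. x \<in> I \<Longrightarrow> (1 - s') * x \<in> ideal_gen (range (($) f'))" and wQ: "(f', g', s') \<in> Q2n"
    using w by (auto simp: w_eq obstruction_data_def Q2n_def)
  have d: "f' $ i - f $ i \<in> ideal_square I" for i
    using f[of i] f'[of i] coset_eq_iff[OF is_ideal_ideal_square] by metis
  define F where "F = (\<chi> i. [:f $ i, f' $ i - f $ i:])"
  define J where "J = ideal_gen (range (($) F))"
  let ?E = "extended_ideal I"
  have J: "is_ideal J" unfolding J_def by (rule is_ideal_ideal_gen)
  have E: "is_ideal ?E" by (rule is_ideal_extended_ideal)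
  have K: "is_ideal (ideal_square ?E)" by (rule is_ideal_ideal_square)
  \<comment> \<open>Use \<open>x = (1 - s) * x + s * x\<close>, with \<open>(1 - s) * x\<close> in \<open>(f)\<close> and \<open>s * x\<close> in \<open>I\<^sup>2\<close>.\<close>
  have "[:x:] \<in> {P. \<exists>j\<in>J. P - j \<in> ideal_square ?E}" if x: "x \<in> I" for x
  proof -
    obtain c :: "'b ^ 'n" where c: "(1 - s) * x = (\<Sum>i\<in>UNIV. f $ i * c $ i)"
      using gen[OF x] unfolding in_ideal_gen_range_iff by blast
    define j where "j = (\<Sum>i\<in>UNIV. F $ i * [:c $ i:])"
    have "j \<in> J" unfolding J_def in_ideal_gen_range_iff j_def
      by (intro exI[of _ "\<chi> i. [:c $ i:]"]) simp
    moreover have "[:x:] - j = [:s * x:] - (\<Sum>i\<in>UNIV. [:0, c $ i:] * [:f' $ i - f $ i:])"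
    proof -
      have "j = (\<Sum>i\<in>UNIV. [:f $ i * c $ i:] + [:0, c $ i:] * [:f' $ i - f $ i:])"
        unfolding j_def F_def by (intro sum.cong) (simp_all add: algebra_simps)
      also have "\<dots> = [:(1 - s) * x:] + (\<Sum>i\<in>UNIV. [:0, c $ i:] * [:f' $ i - f $ i:])"
        by (simp only: sum.distrib sum_const_poly c)
      finally show ?thesis by (simp add: algebra_simps)
    qed
    moreover have "[:s * x:] - (\<Sum>i\<in>UNIV. [:0, c $ i:] * [:f' $ i - f $ i:]) \<in> ideal_square ?E"
      by (intro ideal_diff[OF K] ideal_sum[OF K] ideal_mult_left[OF K]
          const_in_square_extended_ideal mult_in_ideal_square d s x)
    ultimately have "j \<in> J" "[:x:] - j \<in> ideal_square ?E" by (simp_all only:)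
    then show ?thesis by blast
  qed
  then have "?E \<subseteq> {P. \<exists>j\<in>J. P - j \<in> ideal_square ?E}"
    using ideal_gen_minimal[OF _ is_ideal_congruent[OF J K], of "(\<lambda>x. [:x:]) ` I"]
    unfolding extended_ideal_def[symmetric] by blast
  then have "\<exists>S\<in>?E. \<forall>P\<in>?E. (1 - S) * P \<in> J"
    by (intro nakayama[of "(\<lambda>x. [:x:]) ` X"] J)
       (use fg extended_ideal_ideal_gen in auto)
  then obtain S where S: "S \<in> ?E" "\<And>P. P \<in> ?E \<Longrightarrow> (1 - S) * P \<in> J" by blast
  obtain G where G: "(1 - S) * S = (\<Sum>i\<in>UNIV. F $ i * G $ i)"
    using S(2)[OF S(1)] unfolding J_def in_ideal_gen_range_iff by blast
  have H: "(F, G, S) \<in> Q2n"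
    unfolding Q2n_def by (simp flip: G) (simp add: algebra_simps)
  define Gt where "Gt t = (\<chi> i. poly (G $ i) t)" for t
  have mid: "equivclp homotopy_step (f, Gt 0, poly S 0) (f', Gt 1, poly S 1)"
    by (rule homotopicI[OF H]) (simp_all add: Q2n_eval_def F_def Gt_def vec_eq_iff)
  have ends: "(f, Gt 0, poly S 0) \<in> Q2n" "(f', Gt 1, poly S 1) \<in> Q2n"
    using Q2n_eval_in_Q2n[OF H, of 0] Q2n_eval_in_Q2n[OF H, of 1]
    by (simp_all add: Q2n_eval_def F_def Gt_def)
  have St: "poly S t \<in> I" for t by (rule poly_in_ideal[OF I S(1)])
  have Sx: "(1 - poly S t) * x \<in> ideal_gen (range (($) (\<chi> i. poly (F $ i) t)))" if x: "x \<in> I" for x t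
  proof -
    obtain c where "(1 - S) * [:x:] = (\<Sum>i\<in>UNIV. F $ i * c $ i)"
      using S(2)[OF const_in_extended_ideal[OF x]] unfolding J_def in_ideal_gen_range_iff by blast
    then have "poly ((1 - S) * [:x:]) t = poly (\<Sum>i\<in>UNIV. F $ i * c $ i) t" by (rule arg_cong)
    then show ?thesis
      unfolding in_ideal_gen_range_iff
      by (intro exI[of _ "\<chi> i. poly (c $ i) t"]) (simp add: poly_sum mult.commute)
  qed
  have F0: "(\<chi> i. poly (F $ i) 0) = f" and F1: "(\<chi> i. poly (F $ i) 1) = f'"
    by (simp_all add: F_def vec_eq_iff)
  have "equivclp homotopy_step v (f, Gt 0, poly S 0)"
    unfolding v_eq using Sx[of _ 0] gen St s F0 by (intro homotopic_same_lifts vQ ends) auto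
  moreover have "equivclp homotopy_step (f', Gt 1, poly S 1) w"
    unfolding w_eq using Sx[of _ 1] gen' St s' F1 by (intro homotopic_same_lifts wQ ends) auto
  ultimately show ?thesis using mid by (meson equivclp_trans)
qed

section \<open>The homogenised shift\<close>

text \<open>For \<open>degree p \<le> N\<close> this is \<open>T\<^sup>N p(X - T + T\<^sup>-\<^sup>1)\<close>, where \<open>T\<close> is the outer variable: the
  factor \<open>1 + X T - T\<^sup>2\<close> is \<open>T (X - T + T\<^sup>-\<^sup>1)\<close>.\<close>

definition homog_shift :: "nat \<Rightarrow> 'a::comm_ring_1 poly \<Rightarrow> 'a poly poly" where
  "homog_shift N p = (\<Sum>j\<le>N. [:[:coeff p j:]:] * ([:0, 1:] ^ (N - j) * [:1, [:0, 1:], -1:] ^ j))"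

lemma homog_shift_0: "homog_shift N 0 = 0"
  by (simp add: homog_shift_def)

lemma homog_shift_add: "homog_shift N (p + q) = homog_shift N p + homog_shift N q"
proof -
  have c: "[:[:a + b:]:] = [:[:a:]:] + [:[:b:]:]" for a b :: 'a by simp
  show ?thesis
    unfolding homog_shift_def coeff_add c distrib_right sum.distrib ..
qed

lemma homog_shift_smult: "homog_shift N (smult a p) = [:[:a:]:] * homog_shift N p"
proof -
  have c: "[:[:a * b:]:] = [:[:a:]:] * [:[:b:]:]" for a b :: 'a by simp
  show ?thesis
    unfolding homog_shift_def coeff_smult c sum_distrib_left mult.assoc ..
qed

lemma homog_shift_diff: "homog_shift N (p - q) = homog_shift N p - homog_shift N q"
  using homog_shift_add[of N "p - q" q] by simp

lemma homog_shift_sum: "homog_shift N (sum f A) = (\<Sum>x\<in>A. homog_shift N (f x))"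
  by (induction A rule: infinite_finite_induct) (simp_all add: homog_shift_0 homog_shift_add)

lemma homog_shift_pCons:
  "homog_shift (Suc N) (pCons a p) =
     [:[:a:]:] * [:0, 1:] ^ Suc N + [:1, [:0, 1:], -1:] * homog_shift N p"
proof -
  define L T :: "'a poly poly" where "L = [:1, [:0, 1:], -1:]" and "T = [:0, 1:]"
  have "(\<Sum>j\<le>N. [:[:coeff p j:]:] * (T ^ (N - j) * (L * L ^ j))) =
      L * (\<Sum>j\<le>N. [:[:coeff p j:]:] * (T ^ (N - j) * L ^ j))"
    unfolding sum_distrib_left by (intro sum.cong refl) (simp only: mult_ac)
  then show ?thesis
    unfolding homog_shift_def L_def[symmetric] T_def[symmetric] sum.atMost_Suc_shift
    by (simp del: mult_pCons_left)
qed

lemma homog_shift_Suc: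
  assumes "degree p \<le> N"
  shows "homog_shift (Suc N) p = [:0, 1:] * homog_shift N p"
proof -
  define L T :: "'a poly poly" where "L = [:1, [:0, 1:], -1:]" and "T = [:0, 1:]"
  have "(\<Sum>j\<le>N. [:[:coeff p j:]:] * (T ^ (Suc N - j) * L ^ j)) =
      T * (\<Sum>j\<le>N. [:[:coeff p j:]:] * (T ^ (N - j) * L ^ j))"
    unfolding sum_distrib_left
    by (intro sum.cong refl) (simp add: Suc_diff_le mult_ac del: mult_pCons_left mult_pCons_right)
  moreover have "coeff p (Suc N) = 0" using assms by (simp add: coeff_eq_0)
  ultimately show ?thesis
    unfolding homog_shift_def L_def[symmetric] T_def[symmetric] by simp
qed

lemma homog_shift_raise:
  assumes "degree p \<le> N"
  shows "homog_shift (K + N) p = [:0, 1:] ^ K * homog_shift N p"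
proof (induction K)
  case (Suc K)
  have "homog_shift (Suc K + N) p = [:0, 1:] * homog_shift (K + N) p"
    using assms homog_shift_Suc[of p "K + N"] by (simp del: mult_pCons_left)
  then show ?case by (simp only: Suc power_Suc mult.assoc)
qed simp

lemma homog_shift_const: "homog_shift N [:a:] = [:[:a:]:] * [:0, 1:] ^ N"
  using homog_shift_raise[of "[:a:]" 0 N] by (simp add: homog_shift_def mult.commute del: mult_pCons_left)

text \<open>The substitution is a ring homomorphism, so the homogenised forms multiply once the degree
  bounds are added. The recursion \<open>homog_shift_pCons\<close> reduces this to multiplication by \<open>X\<close>.\<close>

lemma homog_shift_mult:
  assumes "degree p \<le> M" "degree q \<le> N"
  shows "homog_shift (M + N) (p * q) = homog_shift M p * homog_shift N q"
  using assms(1)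
proof (induction p arbitrary: M)
  case 0
  then show ?case by (simp add: homog_shift_0)
next
  case (pCons a p)
  define L T :: "'a poly poly" where "L = [:1, [:0, 1:], -1:]" and "T = [:0, 1:]"
  note lt = L_def[symmetric] T_def[symmetric]
  show ?case
  proof (cases "p = 0")
    case True
    have "homog_shift (M + N) (smult a q) = [:[:a:]:] * T ^ M * homog_shift N q"
      by (simp only: homog_shift_smult homog_shift_raise[OF assms(2)] lt mult.assoc)
    moreover have "pCons a p * q = smult a q" using True by simp
    moreover have "homog_shift M (pCons a p) = [:[:a:]:] * T ^ M"
      unfolding True homog_shift_const T_def ..
    ultimately show ?thesis by simp
  next
    case False
    then obtain M' where M: "M = Suc M'" using pCons.prems by (cases M) auto
    have p: "degree p \<le> M'" using pCons.prems False M by simp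
    have "homog_shift (M + N) (pCons a p * q) =
        homog_shift (M + N) (smult a q) + homog_shift (Suc (M' + N)) (pCons 0 (p * q))"
      by (simp add: homog_shift_add M)
    also have "\<dots> = [:[:a:]:] * (T ^ M * homog_shift N q) + L * (homog_shift M' p * homog_shift N q)"
      unfolding homog_shift_smult homog_shift_raise[OF assms(2)] homog_shift_pCons pCons.IH[OF p] lt
      by simp
    also have "\<dots> = homog_shift M (pCons a p) * homog_shift N q"
      unfolding M homog_shift_pCons lt by (simp only: distrib_right mult.assoc)
    finally show ?thesis .
  qed
qed

lemma poly_homog_shift_0: "poly (homog_shift N p) 0 = [:coeff p N:]"
proof -
  have "poly (homog_shift N p) 0 = (\<Sum>j\<le>N. [:coeff p j:] * 0 ^ (N - j))"
    by (simp add: homog_shift_def poly_sum del: mult_pCons_left)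
  also have "\<dots> = (\<Sum>j\<le>N. if j = N then [:coeff p j:] else 0)"
    by (intro sum.cong) (auto simp: power_0_left)
  finally show ?thesis by simp
qed

lemma poly_homog_shift_1:
  assumes "degree p \<le> N"
  shows "poly (homog_shift N p) 1 = p"
proof -
  have "poly (homog_shift N p) 1 = (\<Sum>j\<le>N. [:coeff p j:] * [:0, 1:] ^ j)"
    by (simp add: homog_shift_def poly_sum del: mult_pCons_left)
  also have "\<dots> = (\<Sum>j\<le>N. monom (coeff p j) j)"
    by (intro sum.cong) (simp_all add: monom_altdef)
  also have "\<dots> = p" by (rule poly_as_sum_of_monoms'[OF assms])
  finally show ?thesis .
qed

section \<open>Contracting a presentation with a monic entry\<close>

text \<open>Here \<open>n \<ge> 1\<close> matters. The path \<open>s = T\<close> from \<open>s = 1\<close> to \<open>s = 0\<close> needs an entry to carry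
  \<open>T * (1 - T)\<close>, and its endpoints are joined to \<open>(0, g, 1)\<close> and \<open>(0, 0, 0)\<close> by scaling \<open>f\<close> or
  \<open>g\<close> while the other one is zero.\<close>

lemma homotopic_zero_of_unit:
  fixes g :: "'b::comm_ring_1 ^ 'n::finite"
  shows "equivclp homotopy_step (0, g, 1) (0, 0, 0)"
proof -
  obtain k :: 'n where True by blast
  define e where "e c = (\<chi> i :: 'n. if i = k then c else 0)" for c :: "'b poly"
  define u where "u = (\<chi> i :: 'n. if i = k then 1 else (0 :: 'b))"
  have e: "poly (e c $ i) t = (if i = k then poly c t else 0)" for c i t by (simp add: e_def)
  have e_mult: "(\<Sum>i\<in>UNIV. e c $ i * e d $ i) = c * d" for c d
    by (simp add: e_def if_distrib[of "\<lambda>x. x * _"] cong: if_cong)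
  have "equivclp homotopy_step (0, 0, 1) (0, g, 1)"
    by (rule homotopicI[of 0 "\<chi> i. [:0, g $ i:]" 1])
       (simp_all add: Q2n_def Q2n_eval_def vec_eq_iff)
  moreover have "equivclp homotopy_step (0, 0, 1) (u, 0, 1)"
    by (rule homotopicI[of "e [:0, 1:]" 0 1])
       (simp_all add: Q2n_def Q2n_eval_def vec_eq_iff e u_def)
  moreover have "equivclp homotopy_step (0, u, 0) (u, 0, 1)"
    by (rule homotopicI[of "e [:0, 1:]" "e [:1, -1:]" "[:0, 1:]"])
       (simp_all add: Q2n_def Q2n_eval_def vec_eq_iff e u_def e_mult one_pCons)
  moreover have "equivclp homotopy_step (0, 0, 0) (0, u, 0)"
    by (rule homotopicI[of 0 "e [:0, 1:]" 0])
       (simp_all add: Q2n_def Q2n_eval_def vec_eq_iff e u_def)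
  ultimately show ?thesis by (meson equivclp_trans equivclp_sym)
qed

text \<open>Modulo \<open>J\<close>, the element \<open>E\<close> is idempotent and \<open>S0 * S0 = E * S0\<close>. Then \<open>E * S0\<close> is an
  idempotent orthogonal to \<open>1 - E\<close>, and \<open>S\<close> is their sum.\<close>

lemma idempotent_mod_ideal:
  fixes E S0 :: "'b::comm_ring_1"
  assumes J: "is_ideal J" and E: "E - E * E \<in> J" and S0: "S0 * (S0 - E) \<in> J"
  defines "S \<equiv> 1 - E * (1 - S0)"
  shows "(1 - S) * S \<in> J"
proof -
  have "(1 - S) * S = (1 - S0 + E * S0) * (E - E * E) - E * E * (S0 * (S0 - E))"
    by (simp add: S_def algebra_simps)
  also have "\<dots> \<in> J" by (intro ideal_diff[OF J] ideal_mult_left[OF J] E S0)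
  finally show ?thesis .
qed

lemma one_minus_power_dvd: "(1 - e) dvd (1 - e ^ N)" for e :: "'b::comm_ring_1"
  by (metis dvd_triv_left one_diff_power_eq)

text \<open>Let \<open>p\<close>, \<open>r\<close>, \<open>q\<close> be the homogenised forms of \<open>f\<close>, \<open>g\<close>, \<open>s\<close> for a common bound \<open>N\<close>. The
  equation of the quadric becomes \<open>\<Sum> p\<^sub>i r\<^sub>i + q (q - T\<^sup>N) = 0\<close>. Put \<open>F\<^sub>i = h\<^sup>N p\<^sub>i\<close>, where
  \<open>P = 1 - T h\<close> comes from the monic entry. Multiplying by \<open>h\<^sup>2\<^sup>N\<close> gives, modulo \<open>(F)\<close>,
  \<open>S\<^sub>0 (S\<^sub>0 - E) = 0\<close> for \<open>S\<^sub>0 = h\<^sup>N q\<close> and \<open>E = (T h)\<^sup>N\<close>. Modulo \<open>(F)\<close> the element \<open>E\<close> is an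
  idempotent, as \<open>E (1 - T h) = h\<^sup>N T\<^sup>N P\<close> is a multiple of \<open>F\<^sub>k\<close>, where \<open>k\<close> is the index of the
  monic entry. So
  \<open>S = 1 - E (1 - S\<^sub>0)\<close> completes \<open>F\<close> to a homotopy. At \<open>T = 0\<close> one has \<open>E = 0\<close>, hence
  \<open>S = 1\<close>. At \<open>T = 1\<close> all of the correcting factors are powers of \<open>u = 1 - f\<^sub>k\<close>, which is \<open>1\<close>
  modulo \<open>I\<close>, so the lifts change only by elements of \<open>I\<^sup>2\<close>.\<close>

lemma monic_presentation_contractible:
  fixes f g :: "'a::comm_ring_1 poly ^ 'n::finite"
  assumes I: "is_ideal I" and v: "(f, g, s) \<in> obstruction_data I \<omega>"
    and monic: "lead_coeff (f $ k) = 1"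
  shows "\<exists>w\<in>obstruction_data I \<omega>. equivclp homotopy_step (0, 0, 0) w"
proof -
  have f: "\<And>i. f $ i \<in> I" "\<And>i. \<omega> (axis i 1) = f $ i +o ideal_square I" and s: "s \<in> I"
    and gen: "\<And>x. x \<in> I \<Longrightarrow> (1 - s) * x \<in> ideal_gen (range (($) f))"
    and Q: "(\<Sum>i\<in>UNIV. f $ i * g $ i) + s * (s - 1) = 0"
    using v by (auto simp: obstruction_data_def)
  \<comment> \<open>The bound is strict for \<open>f\<close>, so that all entries of \<open>F\<close> vanish at \<open>T = 0\<close>.\<close>
  define N where "N = Suc (degree s + (\<Sum>i\<in>UNIV. degree (f $ i)) + (\<Sum>i\<in>UNIV. degree (g $ i)))"
  have le: "degree (h $ i) \<le> (\<Sum>i\<in>UNIV. degree (h $ i))" for h :: "'a poly ^ 'n" and i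
    by (rule member_le_sum) auto
  have deg: "degree (f $ i) < N" "degree (g $ i) \<le> N" "degree s \<le> N" "0 < N" for i
    using le[of f i] le[of g i] by (simp_all add: N_def)
  define d where "d = degree (f $ k)"
  define T :: "'a poly poly" where "T = [:0, 1:]"
  define P where "P = homog_shift d (f $ k)"
  have "poly P 0 = 1" using monic by (simp add: P_def poly_homog_shift_0 d_def)
  moreover obtain a Q where "P = pCons a Q" by (cases P)
  ultimately have "P = 1 - T * (- Q)" by (simp add: T_def one_pCons[where 'a = "'a poly"])
  then obtain h where P: "P = 1 - T * h" by blast
  have P1: "poly P 1 = f $ k" unfolding P_def by (intro poly_homog_shift_1) (simp add: d_def)
  have T01: "poly T 0 = 0" "poly T 1 = 1" by (simp_all add: T_def)
  define u where "u = 1 - f $ k"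
  have h1: "poly h 1 = u" using P1 T01 by (simp add: P u_def algebra_simps)
  define p where "p i = homog_shift N (f $ i)" for i
  define r where "r i = homog_shift N (g $ i)" for i
  define q where "q = homog_shift N s"
  have p_k: "p k = T ^ (N - d) * P"
    using homog_shift_raise[of "f $ k" d "N - d"] deg(1)[of k] by (simp add: p_def P_def T_def d_def)
  have pq: "(\<Sum>i\<in>UNIV. p i * r i) + q * (q - T ^ N) = 0"
  proof -
    have "0 = homog_shift (N + N) ((\<Sum>i\<in>UNIV. f $ i * g $ i) + (s * s - s))"
      using Q by (simp add: homog_shift_0 right_diff_distrib)
    also have "\<dots> = (\<Sum>i\<in>UNIV. p i * r i) + (q * q - T ^ N * q)"
      using deg(1)[THEN less_imp_le] deg(2,3)
      by (simp only: homog_shift_add homog_shift_diff homog_shift_sum homog_shift_mult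
          homog_shift_raise p_def r_def q_def T_def)
    finally show ?thesis by (simp add: algebra_simps)
  qed
  define F where "F = (\<chi> i. h ^ N * p i)"
  define J where "J = ideal_gen (range (($) F))"
  define E where "E = (T * h) ^ N"
  define S0 where "S0 = h ^ N * q"
  define S where "S = 1 - E * (1 - S0)"
  have J: "is_ideal J" unfolding J_def by (rule is_ideal_ideal_gen)
  have FJ: "F $ i \<in> J" for i unfolding J_def by (intro ideal_gen_base) simp
  have "E * (1 - T * h) = T ^ d * F $ k"
  proof -
    have "T ^ N = T ^ d * T ^ (N - d)"
      using deg(1)[of k] by (simp add: d_def flip: power_add)
    then show ?thesis by (simp add: E_def F_def p_k P power_mult_distrib mult_ac)
  qed
  then have "E * (1 - T * h) \<in> J" using ideal_mult_left[OF J FJ] by simp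
  moreover obtain c where "1 - E = (1 - T * h) * c"
    using one_minus_power_dvd[of "T * h" N] unfolding E_def by (rule dvdE)
  then have "E - E * E = E * (1 - T * h) * c"
    by (metis mult.assoc mult.right_neutral right_diff_distrib)
  ultimately have EJ: "E - E * E \<in> J" using ideal_mult_right[OF J] by simp
  have "S0 * (S0 - E) = h ^ N * h ^ N * (q * (q - T ^ N))"
    by (simp add: S0_def E_def power_mult_distrib algebra_simps)
  also have "\<dots> = - (\<Sum>i\<in>UNIV. (h ^ N * r i) * F $ i)"
    using pq by (simp add: F_def add_eq_0_iff sum_distrib_left mult_ac flip: sum_negf)
  also have "\<dots> \<in> J" by (intro ideal_uminus[OF J] ideal_sum[OF J] ideal_mult_left[OF J] FJ)
  finally have "(1 - S) * S \<in> J" unfolding S_def by (rule idempotent_mod_ideal[OF J EJ])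
  then obtain G where G: "(1 - S) * S = (\<Sum>i\<in>UNIV. F $ i * G $ i)"
    unfolding J_def in_ideal_gen_range_iff by blast
  have H: "(F, G, S) \<in> Q2n" unfolding Q2n_def by (simp flip: G) (simp add: algebra_simps)
  define Gt where "Gt t = (\<chi> i. poly (G $ i) t)" for t
  define f1 where "f1 = (\<chi> i. u ^ N * f $ i)"
  define s1 where "s1 = 1 - u ^ N * (1 - u ^ N * s)"
  have "poly (F $ i) 0 = 0" for i
    using deg(1)[of i] by (simp add: F_def p_def poly_homog_shift_0 coeff_eq_0)
  moreover have "poly S 0 = 1" using deg(4) by (simp add: S_def E_def T01 power_0_left)
  ultimately have H0: "Q2n_eval 0 (F, G, S) = (0, Gt 0, 1)"
    by (simp add: Q2n_eval_def Gt_def vec_eq_iff)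
  have "poly (F $ i) 1 = f1 $ i" for i
    using deg(1)[of i] by (simp add: F_def p_def poly_homog_shift_1 h1 f1_def)
  moreover have "poly S 1 = s1"
    using deg(3) by (simp add: S_def E_def T01 S0_def q_def poly_homog_shift_1 h1 s1_def)
  ultimately have H1: "Q2n_eval 1 (F, G, S) = (f1, Gt 1, s1)"
    by (simp add: Q2n_eval_def Gt_def vec_eq_iff)
  obtain y where y: "1 - u ^ N = f $ k * y"
    using one_minus_power_dvd[of u N] by (auto simp: u_def)
  have "(f1, Gt 1, s1) \<in> obstruction_data I \<omega>"
  proof -
    have "f1 $ i \<in> I" for i by (simp add: f1_def ideal_mult_left[OF I f(1)])
    moreover have "\<omega> (axis i 1) = f1 $ i +o ideal_square I" for i
    proof -
      have "f $ i - f1 $ i = f $ k * (y * f $ i)"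
        unfolding mult.assoc[symmetric] y[symmetric] by (simp add: f1_def left_diff_distrib)
      then have "f $ i - f1 $ i \<in> ideal_square I"
        by (simp add: mult_in_ideal_square f(1) ideal_mult_left[OF I])
      then show ?thesis using f(2) coset_eq_iff[OF is_ideal_ideal_square] by metis
    qed
    moreover have "s1 \<in> I"
    proof -
      have "s1 = f $ k * y + u ^ N * u ^ N * s" unfolding y[symmetric]
        by (simp add: s1_def algebra_simps)
      then show ?thesis
        by (simp add: ideal_add[OF I] ideal_mult_right[OF I f(1)] ideal_mult_left[OF I s])
    qed
    moreover have "(1 - s1) * x \<in> ideal_gen (range (($) f1))" if x: "x \<in> I" for x
    proof -
      obtain c where c: "(1 - s) * x = (\<Sum>i\<in>UNIV. f $ i * c $ i)"
        using gen[OF x] unfolding in_ideal_gen_range_iff by blast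
      have "(1 - s1) * x = u ^ N * ((1 - s) * x) + u ^ N * (1 - u ^ N) * (s * x)"
        by (simp add: s1_def algebra_simps)
      also have "\<dots> = (\<Sum>i\<in>UNIV. c $ i * f1 $ i) + (y * s * x) * f1 $ k"
        unfolding c y by (simp add: f1_def sum_distrib_left mult_ac)
      also have "\<dots> \<in> ideal_gen (range (($) f1))"
        by (intro ideal_add[OF is_ideal_ideal_gen] ideal_sum[OF is_ideal_ideal_gen]
            ideal_mult_left[OF is_ideal_ideal_gen] ideal_gen_base rangeI)
      finally show ?thesis .
    qed
    moreover have "(\<Sum>i\<in>UNIV. f1 $ i * Gt 1 $ i) + s1 * (s1 - 1) = 0"
      using Q2n_eval_in_Q2n[OF H, of 1] unfolding H1 by (simp add: Q2n_def)
    ultimately show ?thesis by (simp add: obstruction_data_def)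
  qed
  moreover have "equivclp homotopy_step (0, 0, 0) (f1, Gt 1, s1)"
    using equivclp_trans[OF equivclp_sym[OF homotopic_zero_of_unit] homotopicI[OF H H0 H1]] .
  ultimately show ?thesis by blast
qed

section \<open>Vanishing of the obstruction class\<close>

text \<open>Adding \<open>X\<^sup>r m\<^sup>2\<close> with \<open>r\<close> larger than the degree of \<open>a\<close> makes the polynomial monic and
  changes it only by an element of \<open>I\<^sup>2\<close>.\<close>

lemma monic_lift_exists:
  fixes a m :: "'a::comm_ring_1 poly"
  assumes I: "is_ideal I" and m: "m \<in> I" "lead_coeff m = 1"
  shows "\<exists>b. lead_coeff b = 1 \<and> b - a \<in> ideal_square I"
proof -
  define k where "k = Suc (degree a) + (degree m + degree m)"
  define c where "c = monom 1 (Suc (degree a)) * (m * m)"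
  have "coeff (m * m) (degree m + degree m) = 1"
    using m(2) by (simp add: coeff_mult_degree_sum)
  then have ck: "coeff c k = 1" by (simp add: c_def k_def coeff_monom_mult)
  have "degree c \<le> k"
    unfolding c_def k_def
    by (intro order_trans[OF degree_mult_le] add_mono degree_monom_le degree_mult_le)
  then have "degree (a + c) \<le> k" by (intro degree_add_le) (simp_all add: k_def)
  moreover have top: "coeff (a + c) k = 1" using ck by (simp add: k_def coeff_eq_0)
  moreover from this have "k \<le> degree (a + c)" by (intro le_degree) simp
  ultimately have "lead_coeff (a + c) = 1" by (metis le_antisym)
  moreover have "(a + c) - a \<in> ideal_square I"
    using m(1) by (simp add: c_def ideal_mult_left[OF is_ideal_ideal_square] mult_in_ideal_square)
  ultimately show ?thesis by blast
qed

lemma obstruction_data_with_monic_entry: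
  fixes I :: "'a::comm_ring_1 poly set" and \<omega> :: "'a poly ^ 'n::finite \<Rightarrow> 'a poly set"
  assumes fg: "finite X" "I = ideal_gen X" and m: "m \<in> I" "lead_coeff m = 1"
    and or: "local_orientation I \<omega>"
  shows "\<exists>f g s. (f, g, s) \<in> obstruction_data I \<omega> \<and> lead_coeff (f $ k) = 1"
proof -
  have I: "is_ideal I" using fg is_ideal_ideal_gen by simp
  have "\<exists>x. x \<in> I \<and> \<omega> (axis i 1) = x +o ideal_square I" for i
    using or unfolding local_orientation_def conormal_def by blast
  then obtain a where a: "\<And>i. a i \<in> I" "\<And>i. \<omega> (axis i 1) = a i +o ideal_square I" by metis
  obtain b where b: "lead_coeff b = 1" "b - a k \<in> ideal_square I"
    using monic_lift_exists[OF I m] by blast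
  have "(b - a k) + a k \<in> I" using b(2) ideal_square_subset[OF I] a(1) by (intro ideal_add[OF I]) blast+
  then have bI: "b \<in> I" by simp
  have b_lift: "\<omega> (axis k 1) = b +o ideal_square I"
    using b(2) a(2) coset_eq_iff[OF is_ideal_ideal_square] by metis
  define f where "f = (\<chi> i. if i = k then b else a i)"
  have fI: "f $ i \<in> I" and f: "\<omega> (axis i 1) = f $ i +o ideal_square I" for i
    using a bI b_lift by (auto simp: f_def)
  obtain s where s: "s \<in> I" "\<forall>x\<in>I. (1 - s) * x \<in> ideal_gen (range (($) f))"
    using nakayama[OF fg is_ideal_ideal_gen orientation_lifts_generate[OF or f]] by blast
  then obtain g where g: "(1 - s) * s = (\<Sum>i\<in>UNIV. f $ i * g $ i)"
    unfolding in_ideal_gen_range_iff by blast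
  have "(\<Sum>i\<in>UNIV. f $ i * g $ i) + s * (s - 1) = 0"
    unfolding g[symmetric] by (simp add: algebra_simps)
  then have "(f, g, s) \<in> obstruction_data I \<omega>"
    using fI f s by (simp add: obstruction_data_def)
  moreover have "lead_coeff (f $ k) = 1" using b(1) by (simp add: f_def)
  ultimately show ?thesis by blast
qed

lemma pi0_class_eqI:
  assumes "v \<in> Q2n" "w \<in> Q2n" "equivclp homotopy_step v w"
  shows "pi0_class v = pi0_class w"
  unfolding pi0_class_def
  by (rule equiv_class_eq[OF equiv_homotopy_rel]) (use assms in \<open>simp add: homotopy_rel_def\<close>)

theorem proposition4p1:
  fixes \<iota> :: "'k::field \<Rightarrow> 'a::comm_ring_1"
    and I :: "'a poly set"
    and \<omega> :: "'a poly ^ 'n \<Rightarrow> 'a poly set"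
  assumes "(2::'k) \<noteq> 0"
    and "is_ring_hom \<iota>"
    and "noetherian TYPE('a)"
    and "is_ideal I"
    and "\<exists>p\<in>I. lead_coeff p = 1"
    and "local_orientation I \<omega>"
  shows "obstruction_class I \<omega> = pi0_class (0, 0, 0)"
proof -
  obtain m where m: "m \<in> I" "lead_coeff m = 1" using assms(5) by blast
  obtain X where X: "finite X" "I = ideal_gen X"
    using finitely_generated_if_monic[OF assms(3,4) m] by blast
  \<comment> \<open>Any index can carry the monic lift.\<close>
  obtain f g s where "(f, g, s) \<in> obstruction_data I \<omega>" "lead_coeff (f $ (undefined :: 'n)) = 1"
    using obstruction_data_with_monic_entry[OF X m assms(6)] by blast
  from monic_presentation_contractible[OF assms(4) this]
  obtain w where w: "w \<in> obstruction_data I \<omega>" "equivclp homotopy_step (0, 0, 0) w" by blast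
  have Q: "v \<in> Q2n" if "v \<in> obstruction_data I \<omega>" for v
    using that by (auto simp: obstruction_data_def Q2n_def)
  have "pi0_class v = pi0_class (0, 0, 0)" if v: "v \<in> obstruction_data I \<omega>" for v
    using equivclp_trans[OF w(2) obstruction_data_homotopic[OF X w(1) v]]
    by (intro pi0_class_eqI[symmetric] zero_in_Q2n Q v)
  then show ?thesis
    unfolding obstruction_class_def using w(1) by (intro the_equality) blast+
qed

end
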